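(* Let $K\ge 1$ and $\mathcal K=\{1,\dots,K\}$, and suppose that all hypotheses are true nulls ($\mathcal N=\mathcal K$), so that $\mathbf P=(P_1,\dots,P_K)$ is a random vector each of whose components is a p-variable. Let $$S_K(p_1,\dots,p_K)=\min_{1\le k\le K}\frac{K}{k}\,p_{(k)},$$ where $p_{(k)}$ is the $k$-th smallest order statistic of $p_1,\dots,p_K$. (i) If $P_1,\dots,P_K$ satisfy positive regression dependence on the subset $\mathcal N=\mathcal K$ (PRDS), then $$\mathbb P(S_K(\mathbf P)\le\alpha)\le\alpha\quad\text{for all }\alpha\in[0,1].$$ (ii) If $P_1,\dots,P_K$ are iid uniform on $[0,1]$, then $S_K(\mathbf P)$ is also uniformly distributed on $[0,1]$.
   Context: A p-variable is a random variable $P$ with $\mathbb P(P\le t)\le t$ for all $t\in(0,1)$; p-values here take values in $[0,\infty)$. PRDS: vector inequalities are component-wise and "increasing" is in the non-strict sense. A set $A\subseteq\mathbb R^K$ is increasing if $\mathbf x\in A$ implies $\mathbf y\in A$ for all $\mathbf y\ge\mathbf x$. The p-values $P_1,\dots,P_K$ satisfy PRDS on $\mathcal N$ if for any $k\in\mathcal N$ and any increasing (Borel) set $A\subseteq\mathbb R^K$, the function $x\mapsto\mathbb P(\mathbf P\in A\mid P_k\le x)$ is increasing, on the set of $x$ with $\mathbb P(P_k\le x)>0$, where it is defined. Here $\mathcal N=\mathcal K$. *)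

theory Defs
  imports "HOL-Probability.Probability"
begin

text \<open>
  Vectors in \<open>\<real>\<^sup>K\<close> are functions on the index set \<open>{1..K}\<close>; Borel sets of \<open>\<real>\<^sup>K\<close> are
  the measurable sets of \<^term>\<open>\<Pi>\<^sub>M i\<in>{1..K}. (borel :: real measure)\<close>, whose space consists of
  functions that are \<^const>\<open>undefined\<close> off \<open>{1..K}\<close>.
\<close>

abbreviation borel_vec :: "nat \<Rightarrow> (nat \<Rightarrow> real) measure" where
  "borel_vec K \<equiv> (\<Pi>\<^sub>M i\<in>{1..K}. borel)"

text \<open>Nonnegativity is required only almost surely, so that every random variable that is
  uniform on \<open>[0, 1]\<close> is a p-variable.\<close>

definition p_variable :: "'a measure \<Rightarrow> ('a \<Rightarrow> real) \<Rightarrow> bool" where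
  "p_variable M P \<longleftrightarrow>
     P \<in> borel_measurable M \<and>
     (AE \<omega> in M. 0 \<le> P \<omega>) \<and>
     (\<forall>t\<in>{0<..<1}. \<P>(\<omega> in M. P \<omega> \<le> t) \<le> t)"

definition increasing_set :: "nat \<Rightarrow> (nat \<Rightarrow> real) set \<Rightarrow> bool" where
  "increasing_set K A \<longleftrightarrow>
     (\<forall>x\<in>A. \<forall>y\<in>space (borel_vec K). (\<forall>i\<in>{1..K}. x i \<le> y i) \<longrightarrow> y \<in> A)"

definition PRDS :: "'a measure \<Rightarrow> nat \<Rightarrow> (nat \<Rightarrow> 'a \<Rightarrow> real) \<Rightarrow> nat set \<Rightarrow> bool" where
  "PRDS M K P N \<longleftrightarrow>
     (\<forall>k\<in>N. \<forall>A\<in>sets (borel_vec K). increasing_set K A \<longrightarrow>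
        mono_on {x. \<P>(\<omega> in M. P k \<omega> \<le> x) > 0}
          (\<lambda>x. \<P>(\<omega> in M. (\<lambda>i\<in>{1..K}. P i \<omega>) \<in> A \<bar> P k \<omega> \<le> x)))"

definition order_stat :: "nat \<Rightarrow> (nat \<Rightarrow> real) \<Rightarrow> nat \<Rightarrow> real" where
  "order_stat K p k = sort (map p [1..<Suc K]) ! (k - 1)"

definition simes :: "nat \<Rightarrow> (nat \<Rightarrow> real) \<Rightarrow> real" where
  "simes K p = (MIN k\<in>{1..K}. real K / real k * order_stat K p k)"

definition uniform_01 :: "'a measure \<Rightarrow> ('a \<Rightarrow> real) \<Rightarrow> bool" where
  "uniform_01 M X \<longleftrightarrow>
     X \<in> borel_measurable M \<and> distr M borel X = uniform_measure lborel {0..1}"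

end

theory Submission
  imports Defs
begin

text \<open>
  Put \<open>c = \<alpha> / K\<close> and let \<open>R\<close> be the number of hypotheses that the Benjamini--Hochberg step-up
  procedure at level \<open>\<alpha>\<close> rejects: the largest \<open>k\<close> such that at least \<open>k\<close> of the p-values are at
  most \<open>k c\<close>. Since \<open>p\<^sub>(\<^sub>k\<^sub>) \<le> t\<close> says that at least \<open>k\<close> entries are at most \<open>t\<close>, the event
  \<open>S\<^sub>K(P) \<le> \<alpha>\<close> is the event \<open>R \<ge> 1\<close> (\<open>simes_le_iff\<close>).

  Maximality of \<open>R\<close> forces exactly \<open>R\<close> p-values to lie below \<open>R c\<close>. On \<open>R \<ge> 1\<close> each of them can be
  given the weight \<open>1 / R\<close>, so that the weights add up to one. Taking expectations
  (\<open>prob_step_up_rank_pos\<close>),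
    \<open>\<P>(R \<ge> 1) = (\<Sum>i. \<Sum>r = 1..K. \<P>(P\<^sub>i \<le> r c, R = r) / r)\<close>.
  Both parts follow by evaluating the inner sum for a fixed \<open>i\<close>: it is at most \<open>c\<close> under PRDS and
  equal to \<open>c\<close> for iid uniform p-values, and \<open>K\<close> such terms give \<open>\<alpha>\<close>.

  Under PRDS (\<open>PRDS_sum_le\<close>), write \<open>g r s = \<P>(R \<le> r | P\<^sub>i \<le> s c)\<close>. The \<open>r\<close>-th term equals
  \<open>\<P>(P\<^sub>i \<le> r c) (g r r - g (r - 1) r) / r\<close>, which is at most \<open>c (g r r - g (r - 1) r)\<close> because
  \<open>P\<^sub>i\<close> is a p-variable. Raising p-values can only lower \<open>R\<close>, so \<open>R \<le> r - 1\<close> describes an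
  increasing set and PRDS allows \<open>g (r - 1) r\<close> to be replaced by the smaller
  \<open>g (r - 1) (r - 1)\<close>. The sum then telescopes to at most \<open>c\<close>.

  In the iid uniform case (\<open>indep_uniform_sum_eq\<close>), let \<open>S\<close> be the rank after \<open>P\<^sub>i\<close> is
  replaced by 0. On \<open>P\<^sub>i \<le> r c\<close> the events \<open>R = r\<close> and \<open>S = r\<close> coincide, and \<open>S\<close> is independent
  of \<open>P\<^sub>i\<close>, so the \<open>r\<close>-th term is exactly \<open>c \<P>(S = r)\<close>. Since always \<open>1 \<le> S \<le> K\<close>, these terms add
  up to \<open>c\<close>.
\<close>

section \<open>The step-up rank\<close>

definition count_le :: "'i set \<Rightarrow> ('i \<Rightarrow> real) \<Rightarrow> real \<Rightarrow> nat" where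
  "count_le I p t = card {i \<in> I. p i \<le> t}"

text \<open>
  This is the number of rejections of the Benjamini--Hochberg procedure with critical values
  \<open>k c\<close>. The index 0 always qualifies, so the value 0 means that no hypothesis is rejected; on a
  finite \<open>I\<close> no index above \<open>card I\<close> qualifies, so the maximum exists.
\<close>

definition step_up_rank :: "'i set \<Rightarrow> real \<Rightarrow> ('i \<Rightarrow> real) \<Rightarrow> nat" where
  "step_up_rank I c p = Max {k. k \<le> count_le I p (real k * c)}"

lemma count_le_le_card: "finite I \<Longrightarrow> count_le I p t \<le> card I"
  unfolding count_le_def by (intro card_mono) auto

lemma count_le_mono: "finite I \<Longrightarrow> s \<le> t \<Longrightarrow> count_le I p s \<le> count_le I p t"
  unfolding count_le_def by (intro card_mono) auto

lemma count_le_antimono: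
  "finite I \<Longrightarrow> (\<And>i. i \<in> I \<Longrightarrow> p i \<le> q i) \<Longrightarrow> count_le I q t \<le> count_le I p t"
  unfolding count_le_def by (intro card_mono) force+

lemma count_le_cong: "(\<And>i. i \<in> I \<Longrightarrow> p i \<le> t \<longleftrightarrow> q i \<le> t) \<Longrightarrow> count_le I p t = count_le I q t"
  unfolding count_le_def by (intro arg_cong[where f = card]) auto

lemma finite_ranks:
  assumes "finite I"
  shows "finite {k. k \<le> count_le I p (real k * c)}"
  by (rule finite_subset[of _ "{..card I}"]) (auto intro: order_trans count_le_le_card[OF assms])

lemma step_up_rank_le_iff:
  assumes "finite I"
  shows "step_up_rank I c p \<le> r \<longleftrightarrow> (\<forall>k>r. count_le I p (real k * c) < k)"
proof -
  have "{k. k \<le> count_le I p (real k * c)} \<noteq> {}"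
    by auto
  then show ?thesis
    unfolding step_up_rank_def using finite_ranks[OF assms, of p c]
    by (simp add: Max_le_iff) (meson not_le)
qed

lemma step_up_rank_le_count:
  assumes "finite I"
  shows "step_up_rank I c p \<le> count_le I p (real (step_up_rank I c p) * c)"
proof -
  have "{k. k \<le> count_le I p (real k * c)} \<noteq> {}"
    by auto
  from Max_in[OF finite_ranks[OF assms] this] show ?thesis
    unfolding step_up_rank_def by auto
qed

lemma step_up_rank_le_card: "finite I \<Longrightarrow> step_up_rank I c p \<le> card I"
  using step_up_rank_le_count count_le_le_card by (meson order_trans)

text \<open>
  If more than \<open>r\<close> entries were below \<open>r c\<close> at the rank \<open>r\<close>, then at least \<open>r + 1\<close> of them would be
  below the larger critical value \<open>(r + 1) c\<close>, and the rank would be at least \<open>r + 1\<close>.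
\<close>

lemma count_at_step_up_rank:
  assumes "finite I" "0 \<le> c"
  shows "count_le I p (real (step_up_rank I c p) * c) = step_up_rank I c p"
proof (rule antisym)
  let ?r = "step_up_rank I c p"
  have "count_le I p (real ?r * c) \<le> count_le I p (real (Suc ?r) * c)"
    using assms by (intro count_le_mono mult_right_mono) auto
  also have "\<dots> < Suc ?r"
    using step_up_rank_le_iff[OF assms(1), of c p ?r] by blast
  finally show "count_le I p (real ?r * c) \<le> ?r"
    by simp
qed (rule step_up_rank_le_count[OF assms(1)])

lemma step_up_rank_antimono:
  assumes "finite I" "\<And>i. i \<in> I \<Longrightarrow> p i \<le> q i"
  shows "step_up_rank I c q \<le> step_up_rank I c p"
proof -
  have "count_le I q (real k * c) < k" if "step_up_rank I c p < k" for k
  proof -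
    have "count_le I q (real k * c) \<le> count_le I p (real k * c)"
      using assms by (rule count_le_antimono)
    also have "\<dots> < k"
      using that step_up_rank_le_iff[OF assms(1), of c p "step_up_rank I c p"] by blast
    finally show ?thesis .
  qed
  then show ?thesis
    using step_up_rank_le_iff[OF assms(1)] by blast
qed

lemma step_up_rank_cong:
  assumes "finite I" "\<And>i. i \<in> I \<Longrightarrow> p i = q i"
  shows "step_up_rank I c p = step_up_rank I c q"
  using assms by (intro antisym step_up_rank_antimono) auto

text \<open>
  Whether the rank is \<open>r\<close> depends only on the counts at the critical values \<open>k c\<close> with \<open>k \<ge> r\<close>, and
  these do not see where below \<open>r c\<close> the \<open>i\<close>-th entry lies. In the independent case this removes
  the dependence of the rank on the \<open>i\<close>-th p-value.
\<close>

lemma step_up_rank_upd_eq_iff: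
  assumes "finite I" "0 \<le> c" "p i \<le> real r * c" "x \<le> real r * c"
  shows "step_up_rank I c (p(i := x)) = r \<longleftrightarrow> step_up_rank I c p = r"
proof -
  have eq_iff: "step_up_rank I c q = r \<longleftrightarrow>
      r \<le> count_le I q (real r * c) \<and> (\<forall>k>r. count_le I q (real k * c) < k)" for q
  proof
    assume "step_up_rank I c q = r"
    then show "r \<le> count_le I q (real r * c) \<and> (\<forall>k>r. count_le I q (real k * c) < k)"
      using step_up_rank_le_count[OF assms(1), of c q] step_up_rank_le_iff[OF assms(1), of c q r]
      by auto
  next
    assume *: "r \<le> count_le I q (real r * c) \<and> (\<forall>k>r. count_le I q (real k * c) < k)"
    then have "step_up_rank I c q \<le> r"
      using step_up_rank_le_iff[OF assms(1)] by blast
    moreover have "\<not> step_up_rank I c q < r"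
      using step_up_rank_le_iff[OF assms(1), of c q "step_up_rank I c q"] * by (auto simp: not_less)
    ultimately show "step_up_rank I c q = r"
      by simp
  qed
  have "count_le I (p(i := x)) (real k * c) = count_le I p (real k * c)" if "r \<le> k" for k
  proof (rule count_le_cong)
    have "real r * c \<le> real k * c"
      using that assms(2) by (intro mult_right_mono) auto
    with assms(3,4) show "(p(i := x)) j \<le> real k * c \<longleftrightarrow> p j \<le> real k * c" for j
      by auto
  qed
  then show ?thesis
    unfolding eq_iff by auto
qed

lemma step_up_rank_upd_zero_pos:
  assumes "finite I" "0 \<le> c" "i \<in> I"
  shows "1 \<le> step_up_rank I c (p(i := 0))"
proof -
  have "{i} \<subseteq> {j \<in> I. (p(i := 0)) j \<le> real 1 * c}"
    using assms by auto
  then have "1 \<le> count_le I (p(i := 0)) (real 1 * c)"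
    unfolding count_le_def using card_mono[of "{j \<in> I. (p(i := 0)) j \<le> real 1 * c}" "{i}"] assms(1)
    by simp
  then show ?thesis
    using step_up_rank_le_iff[OF assms(1), of c "p(i := 0)" 0] by (force simp: not_less)
qed

text \<open>
  Only \<open>r\<close> equal to the rank contributes, and for it the sum over \<open>i\<close> counts the entries below
  \<open>r c\<close>, of which there are exactly \<open>r\<close>.
\<close>

lemma indicator_step_up_rank_pos:
  assumes "finite I" "0 \<le> c"
  shows "(of_bool (1 \<le> step_up_rank I c p) :: real) =
    (\<Sum>i\<in>I. \<Sum>r\<in>{1..card I}. of_bool (p i \<le> real r * c \<and> step_up_rank I c p = r) / real r)"
proof -
  let ?R = "step_up_rank I c p"
  have "(\<Sum>i\<in>I. \<Sum>r\<in>{1..card I}. of_bool (p i \<le> real r * c \<and> ?R = r) / real r) =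
      (\<Sum>i\<in>I. \<Sum>r\<in>{1..card I}. if ?R = r then of_bool (p i \<le> real ?R * c) / real ?R else (0::real))"
    by (intro sum.cong) auto
  also have "\<dots> = (if ?R \<in> {1..card I} then (\<Sum>i\<in>I. of_bool (p i \<le> real ?R * c) / real ?R) else 0)"
    by (cases "?R \<in> {1..card I}") (simp_all del: atLeastAtMost_iff)
  also have "\<dots> = (if 1 \<le> ?R then (\<Sum>i\<in>I. of_bool (p i \<le> real ?R * c)) / real ?R else 0)"
    using step_up_rank_le_card[OF assms(1), of c p] by (auto simp: sum_divide_distrib)
  also have "\<dots> = (if 1 \<le> ?R then real (count_le I p (real ?R * c)) / real ?R else 0)"
    using assms(1) by (simp add: count_le_def Int_def)
  also have "\<dots> = of_bool (1 \<le> ?R)"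
    using count_at_step_up_rank[OF assms] by auto
  finally show ?thesis ..
qed

lemma measurable_step_up_rank [measurable]:
  fixes I :: "nat set"
  assumes [measurable]: "\<And>i. i \<in> I \<Longrightarrow> X i \<in> borel_measurable M"
  shows "(\<lambda>\<omega>. step_up_rank I c (\<lambda>i. X i \<omega>)) \<in> measurable M (count_space UNIV)"
proof -
  have [measurable]: "{\<omega> \<in> space M. i \<in> {i \<in> I. X i \<omega> \<le> real k * c}} \<in> sets M" for i k
    by (cases "i \<in> I") auto
  show ?thesis
    unfolding step_up_rank_def count_le_def by measurable
qed

section \<open>Simes' statistic\<close>

lemma sorted_nth_le_iff:
  fixes xs :: "'a::linorder list"
  assumes "sorted xs" "n < length xs"
  shows "xs ! n \<le> t \<longleftrightarrow> n < length (filter (\<lambda>x. x \<le> t) xs)"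
  using assms
proof (induction xs arbitrary: n)
  case (Cons x xs)
  show ?case
  proof (cases "x \<le> t")
    case True
    with Cons show ?thesis
      by (cases n) auto
  next
    case False
    then have "\<forall>y\<in>set (x # xs). \<not> y \<le> t"
      using Cons.prems by auto
    moreover from this have "filter (\<lambda>x. x \<le> t) (x # xs) = []"
      by (simp add: filter_empty_conv)
    ultimately show ?thesis
      using Cons.prems(2) nth_mem[of n "x # xs"] by auto
  qed
qed simp

lemma order_stat_le_iff:
  assumes "k \<in> {1..K}"
  shows "order_stat K p k \<le> t \<longleftrightarrow> k \<le> count_le {1..K} p t"
proof -
  let ?xs = "map p [1..<Suc K]"
  have "length (filter (\<lambda>x. x \<le> t) (sort ?xs)) = length (filter (\<lambda>x. x \<le> t) ?xs)"
    by (metis mset_filter mset_sort size_mset)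
  also have "\<dots> = card (set (filter (\<lambda>i. p i \<le> t) [1..<Suc K]))"
    by (subst distinct_card) (auto simp: filter_map o_def)
  also have "\<dots> = count_le {1..K} p t"
    unfolding count_le_def by (intro arg_cong[where f = card]) auto
  finally show ?thesis
    unfolding order_stat_def using assms sorted_nth_le_iff[of "sort ?xs" "k - 1" t]
    by (simp del: upt_Suc add: less_eq_Suc_le[symmetric]) linarith
qed

lemma simes_le_iff:
  assumes "1 \<le> K"
  shows "simes K p \<le> \<alpha> \<longleftrightarrow> 1 \<le> step_up_rank {1..K} (\<alpha> / real K) p"
proof -
  define n where "n k = count_le {1..K} p (real k * (\<alpha> / real K))" for k
  have n_le: "n k \<le> K" for k
    unfolding n_def using count_le_le_card[of "{1..K}" p] by simp
  have "simes K p \<le> \<alpha> \<longleftrightarrow> (\<exists>k\<in>{1..K}. real K / real k * order_stat K p k \<le> \<alpha>)"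
    unfolding simes_def using assms by (subst Min_le_iff) auto
  also have "\<dots> \<longleftrightarrow> (\<exists>k\<in>{1..K}. order_stat K p k \<le> real k * (\<alpha> / real K))"
    using assms by (intro bex_cong) (auto simp: field_simps)
  also have "\<dots> \<longleftrightarrow> (\<exists>k\<in>{1..K}. k \<le> n k)"
    unfolding n_def by (intro bex_cong) (auto simp: order_stat_le_iff)
  also have "\<dots> \<longleftrightarrow> (\<exists>k>0. k \<le> n k)"
    using n_le by (metis One_nat_def Suc_le_eq atLeastAtMost_iff order_trans)
  also have "\<dots> \<longleftrightarrow> \<not> step_up_rank {1..K} (\<alpha> / real K) p \<le> 0"
    unfolding n_def using step_up_rank_le_iff[of "{1..K}" "\<alpha> / real K" p 0] by (meson finite_atLeastAtMost not_le)
  also have "\<dots> \<longleftrightarrow> 1 \<le> step_up_rank {1..K} (\<alpha> / real K) p"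
    by linarith
  finally show ?thesis .
qed

section \<open>The probability of a positive rank\<close>

context prob_space
begin

lemma prob_step_up_rank_pos:
  fixes I :: "nat set"
  assumes "finite I" "0 \<le> c" and [measurable]: "\<And>i. i \<in> I \<Longrightarrow> X i \<in> borel_measurable M"
  shows "\<P>(\<omega> in M. 1 \<le> step_up_rank I c (\<lambda>i. X i \<omega>)) =
    (\<Sum>i\<in>I. \<Sum>r\<in>{1..card I}.
      \<P>(\<omega> in M. X i \<omega> \<le> real r * c \<and> step_up_rank I c (\<lambda>i. X i \<omega>) = r) / real r)"
proof -
  let ?R = "\<lambda>\<omega>. step_up_rank I c (\<lambda>i. X i \<omega>)"
  have [measurable]: "?R \<in> measurable M (count_space UNIV)"
    using assms by measurable
  have prob_eq: "prob {\<omega> \<in> space M. Q \<omega>} = (\<integral>\<omega>. of_bool (Q \<omega>) \<partial>M)"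
    and int: "integrable M (\<lambda>\<omega>. of_bool (Q \<omega>) :: real)" if [measurable]: "Measurable.pred M Q" for Q
  proof -
    have *: "(of_bool (Q \<omega>) :: real) = indicator {\<omega> \<in> space M. Q \<omega>} \<omega>" if "\<omega> \<in> space M" for \<omega>
      using that by auto
    show "prob {\<omega> \<in> space M. Q \<omega>} = (\<integral>\<omega>. of_bool (Q \<omega>) \<partial>M)"
      by (simp add: * cong: Bochner_Integration.integral_cong)
    have "integrable M (indicator {\<omega> \<in> space M. Q \<omega>} :: _ \<Rightarrow> real)"
      by (intro integrable_real_indicator) (auto simp: emeasure_eq_measure)
    then show "integrable M (\<lambda>\<omega>. of_bool (Q \<omega>) :: real)"
      by (subst Bochner_Integration.integrable_cong[OF refl *]) auto
  qed
  have ev: "Measurable.pred M (\<lambda>\<omega>. X i \<omega> \<le> real r * c \<and> ?R \<omega> = r)" if "i \<in> I" for i r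
    using that by measurable
  have "prob {\<omega> \<in> space M. 1 \<le> ?R \<omega>} = (\<integral>\<omega>. of_bool (1 \<le> ?R \<omega>) \<partial>M)"
    by (rule prob_eq) measurable
  also have "\<dots> = (\<integral>\<omega>. (\<Sum>i\<in>I. \<Sum>r\<in>{1..card I}.
      of_bool (X i \<omega> \<le> real r * c \<and> ?R \<omega> = r) / real r) \<partial>M)"
    by (simp only: indicator_step_up_rank_pos[OF assms(1,2)])
  also have "\<dots> = (\<Sum>i\<in>I. \<Sum>r\<in>{1..card I}.
      (\<integral>\<omega>. of_bool (X i \<omega> \<le> real r * c \<and> ?R \<omega> = r) \<partial>M) / real r)"
    by (simp add: Bochner_Integration.integral_sum int ev)
  also have "\<dots> = (\<Sum>i\<in>I. \<Sum>r\<in>{1..card I}. prob {\<omega> \<in> space M. X i \<omega> \<le> real r * c \<and> ?R \<omega> = r} / real r)"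
    by (intro sum.cong refl) (simp only: prob_eq ev)
  finally show ?thesis .
qed

section \<open>Positive regression dependence\<close>

text \<open>
  The bound that defines a p-variable extends to the end points: at 1 it is trivial, and at 0 it is
  the limit of the bounds at positive \<open>s\<close>. Both end points occur as critical values, for \<open>\<alpha> = 0\<close> and
  for \<open>r = K\<close>, \<open>\<alpha> = 1\<close>.
\<close>

lemma p_variable_prob_le:
  assumes "p_variable M X" "t \<in> {0..1}"
  shows "\<P>(\<omega> in M. X \<omega> \<le> t) \<le> t"
proof -
  have [measurable]: "X \<in> borel_measurable M"
    and le: "\<And>s. s \<in> {0<..<1} \<Longrightarrow> \<P>(\<omega> in M. X \<omega> \<le> s) \<le> s"
    using assms(1) by (auto simp: p_variable_def)
  consider "t = 0" | "t = 1" | "t \<in> {0<..<1}"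
    using assms(2) by force
  then show ?thesis
  proof cases
    case 1
    have "\<P>(\<omega> in M. X \<omega> \<le> 0) \<le> s" if "0 < s" "s < 1" for s
    proof -
      have "\<P>(\<omega> in M. X \<omega> \<le> 0) \<le> \<P>(\<omega> in M. X \<omega> \<le> s)"
        using that by (intro finite_measure_mono) auto
      also have "\<dots> \<le> s"
        using that by (intro le) auto
      finally show ?thesis .
    qed
    then show ?thesis
      unfolding 1 by (rule dense_ge_bounded[of 0 1, rotated]) auto
  qed (auto intro: le)
qed

text \<open>
  The contribution of one p-value to the decomposition of the probability of a positive rank: the
  p-variable bound turns each term into a multiple of a difference of conditional probabilities,
  and positive dependence makes these differences telescope.
\<close>

lemma PRDS_sum_le:
  assumes PRDS: "PRDS M K X N" and i: "i \<in> N" "i \<in> {1..K}"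
    and p_var: "p_variable M (X i)"
    and meas: "\<And>k. k \<in> {1..K} \<Longrightarrow> X k \<in> borel_measurable M"
    and c: "0 \<le> c" "real K * c \<le> 1"
  shows "(\<Sum>r\<in>{1..K}. \<P>(\<omega> in M. X i \<omega> \<le> real r * c \<and>
      step_up_rank {1..K} c (\<lambda>k. X k \<omega>) = r) / real r) \<le> c"
proof -
  let ?R = "\<lambda>\<omega>. step_up_rank {1..K} c (\<lambda>k. X k \<omega>)"
  define g where "g r s = \<P>(\<omega> in M. ?R \<omega> \<le> r \<bar> X i \<omega> \<le> real s * c)" for r s :: nat
  have [measurable]: "?R \<in> measurable M (count_space UNIV)"
    using meas by measurable
  have [measurable]: "X i \<in> borel_measurable M"
    using i meas by auto
  have g_nonneg: "0 \<le> g r s" and g_le_1: "g r s \<le> 1" for r s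
  proof -
    show "0 \<le> g r s"
      by (auto simp: g_def cond_prob_def)
    have "\<P>(\<omega> in M. ?R \<omega> \<le> r \<and> X i \<omega> \<le> real s * c) \<le> \<P>(\<omega> in M. X i \<omega> \<le> real s * c)"
      by (intro finite_measure_mono) auto
    then show "g r s \<le> 1"
      by (auto simp: g_def cond_prob_def intro!: divide_le_eq_1[THEN iffD2] zero_less_measure_iff[THEN iffD2])
  qed
  have g_mono: "g r s \<le> g r (Suc s)" for r s
  proof (cases "\<P>(\<omega> in M. X i \<omega> \<le> real s * c) > 0")
    case True
    define A where "A = {p \<in> space (borel_vec K). step_up_rank {1..K} c p \<le> r}"
    have "(\<lambda>p. step_up_rank {1..K} c (\<lambda>k. p k)) \<in> measurable (borel_vec K) (count_space UNIV)"
      by (intro measurable_step_up_rank) auto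
    then have "A \<in> sets (borel_vec K)"
      unfolding A_def by measurable
    moreover have "increasing_set K A"
      unfolding increasing_set_def A_def
      by (auto intro: order_trans[OF step_up_rank_antimono])
    ultimately have mono: "mono_on {x. \<P>(\<omega> in M. X i \<omega> \<le> x) > 0}
        (\<lambda>x. \<P>(\<omega> in M. (\<lambda>k\<in>{1..K}. X k \<omega>) \<in> A \<bar> X i \<omega> \<le> x))"
      using PRDS i(1) unfolding PRDS_def by blast
    have "(\<lambda>k\<in>{1..K}. X k \<omega>) \<in> A \<longleftrightarrow> ?R \<omega> \<le> r" for \<omega>
    proof -
      have "step_up_rank {1..K} c (\<lambda>k\<in>{1..K}. X k \<omega>) = ?R \<omega>"
        by (intro step_up_rank_cong) auto
      then show ?thesis
        by (auto simp: A_def space_PiM)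
    qed
    note mono = mono[unfolded this]
    have le: "real s * c \<le> real (Suc s) * c"
      using c(1) by (intro mult_right_mono) auto
    have "\<P>(\<omega> in M. X i \<omega> \<le> real s * c) \<le> \<P>(\<omega> in M. X i \<omega> \<le> real (Suc s) * c)"
      using le by (intro finite_measure_mono) auto
    with True show ?thesis
      unfolding g_def by (intro mono_onD[OF mono _ _ le]) auto
  next
    case False
    \<comment> \<open>PRDS does not speak about conditioning on null events; there the conditional probability has
      the default value 0, which keeps \<open>g\<close> monotone.\<close>
    then have "g r s = 0"
      by (auto simp: g_def cond_prob_def zero_less_measure_iff)
    then show ?thesis
      using g_nonneg by simp
  qed
  have "\<P>(\<omega> in M. X i \<omega> \<le> real r * c \<and> ?R \<omega> = r) / real r \<le> c * (g r r - g (r - 1) (r - 1))"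
    if r: "r \<in> {1..K}" for r
  proof -
    define F where "F = \<P>(\<omega> in M. X i \<omega> \<le> real r * c)"
    \<comment> \<open>This also holds when the conditioning event is null, both sides being 0.\<close>
    have F_mult: "\<P>(\<omega> in M. ?R \<omega> \<le> r' \<and> X i \<omega> \<le> real r * c) = F * g r' r" for r'
    proof (cases "F = 0")
      case True
      have "\<P>(\<omega> in M. ?R \<omega> \<le> r' \<and> X i \<omega> \<le> real r * c) \<le> F"
        unfolding F_def by (intro finite_measure_mono) auto
      with True show ?thesis
        using measure_nonneg[of M] by (simp add: antisym)
    qed (simp add: g_def F_def cond_prob_def)
    have events: "{\<omega> \<in> space M. ?R \<omega> \<le> r' \<and> X i \<omega> \<le> real r * c} \<in> events" for r'
      by measurable
    have "{\<omega> \<in> space M. X i \<omega> \<le> real r * c \<and> ?R \<omega> = r} =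
        {\<omega> \<in> space M. ?R \<omega> \<le> r \<and> X i \<omega> \<le> real r * c} -
        {\<omega> \<in> space M. ?R \<omega> \<le> r - 1 \<and> X i \<omega> \<le> real r * c}"
      using r by auto
    then have "\<P>(\<omega> in M. X i \<omega> \<le> real r * c \<and> ?R \<omega> = r) =
        prob ({\<omega> \<in> space M. ?R \<omega> \<le> r \<and> X i \<omega> \<le> real r * c} -
          {\<omega> \<in> space M. ?R \<omega> \<le> r - 1 \<and> X i \<omega> \<le> real r * c})"
      by (rule arg_cong)
    also have "\<dots> = F * g r r - F * g (r - 1) r"
      unfolding F_mult[symmetric] by (rule finite_measure_Diff[OF events events]) auto
    also have "\<dots> = F * (g r r - g (r - 1) r)"
      by (simp add: algebra_simps)
    also have "\<dots> \<le> (real r * c) * (g r r - g (r - 1) r)"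
    proof (rule mult_right_mono)
      have "real r * c \<le> real K * c"
        using r c(1) by (intro mult_right_mono) auto
      then show "F \<le> real r * c"
        unfolding F_def using c by (intro p_variable_prob_le[OF p_var]) auto
      have "\<P>(\<omega> in M. ?R \<omega> \<le> r - 1 \<and> X i \<omega> \<le> real r * c) \<le> \<P>(\<omega> in M. ?R \<omega> \<le> r \<and> X i \<omega> \<le> real r * c)"
        by (rule finite_measure_mono[OF _ events]) auto
      then show "0 \<le> g r r - g (r - 1) r"
        by (auto simp: g_def cond_prob_def intro!: divide_right_mono)
    qed
    finally have "\<P>(\<omega> in M. X i \<omega> \<le> real r * c \<and> ?R \<omega> = r) / real r \<le> c * (g r r - g (r - 1) r)"
      using r by (simp add: divide_le_eq mult_ac)
    also have "\<dots> \<le> c * (g r r - g (r - 1) (r - 1))"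
      using g_mono[of "r - 1" "r - 1"] r c(1) by (intro mult_left_mono) auto
    finally show ?thesis .
  qed
  then have "(\<Sum>r\<in>{1..K}. \<P>(\<omega> in M. X i \<omega> \<le> real r * c \<and> ?R \<omega> = r) / real r) \<le>
      (\<Sum>r\<in>{1..K}. c * (g r r - g (r - 1) (r - 1)))"
    by (rule sum_mono)
  also have "\<dots> = c * (g K K - g 0 0)"
    using sum_telescope''[of 0 K "\<lambda>r. g r r"]
    by (simp add: sum_distrib_left[symmetric] atLeastSucAtMost_greaterThanAtMost)
  also have "\<dots> \<le> c * 1"
    using g_le_1[of K K] g_nonneg[of 0 0] c(1) by (intro mult_left_mono) auto
  finally show ?thesis
    by simp
qed

section \<open>Independent uniform p-values\<close>

text \<open>The distribution function on the unit interval already determines the uniform law.\<close>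

lemma uniform_01_iff:
  "uniform_01 M X \<longleftrightarrow>
    X \<in> borel_measurable M \<and> (\<forall>t\<in>{0..1}. \<P>(\<omega> in M. X \<omega> \<le> t) = t)"
proof -
  have "uniform_measure lborel {0..1::real} =
      density lborel (\<lambda>x. ennreal (indicator {0..1} x / measure lborel {0..1::real}))"
    unfolding uniform_measure_def
    by (intro arg_cong[where f = "density lborel"] ext) (simp split: split_indicator)
  moreover have "distr M borel X = distr M lborel X"
    by (intro distr_cong) auto
  ultimately have "uniform_01 M X \<longleftrightarrow>
      distributed M lborel X (\<lambda>x. indicator {0..1} x / measure lborel {0..1::real})"
    unfolding uniform_01_def distributed_def by (auto simp del: content_real_if)
  then show ?thesis
    unfolding uniform_distributed_iff by simp
qed

text \<open>
  Replacing the \<open>i\<close>-th entry by 0 gives a rank \<open>S\<close> that depends on the other p-values only, without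
  changing the event under consideration. The factor \<open>\<P>(X\<^sub>i \<le> r c) = r c\<close> then cancels the
  weight \<open>1 / r\<close>, and \<open>S\<close> takes all its values in \<open>{1..card I}\<close>.
\<close>

lemma indep_uniform_sum_eq:
  fixes I :: "nat set"
  assumes indep: "indep_vars (\<lambda>_. borel) X I" and fin: "finite I" and i: "i \<in> I"
    and unif: "uniform_01 M (X i)" and c: "0 \<le> c" "real (card I) * c \<le> 1"
  shows "(\<Sum>r\<in>{1..card I}. \<P>(\<omega> in M. X i \<omega> \<le> real r * c \<and>
      step_up_rank I c (\<lambda>k. X k \<omega>) = r) / real r) = c"
proof -
  let ?R = "\<lambda>\<omega>. step_up_rank I c (\<lambda>k. X k \<omega>)"
  let ?J = "I - {i}"
  \<comment> \<open>The rank is taken as a real number because both members of an independent pair have the same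
    type.\<close>
  define Q where "Q p = real (step_up_rank I c (p(i := 0)))" for p
  define S where "S \<omega> = Q (\<lambda>k. X k \<omega>)" for \<omega>
  have "(\<lambda>p. step_up_rank I c (p(i := 0))) \<in> measurable (PiM ?J (\<lambda>_. borel)) (count_space UNIV)"
  proof (rule measurable_step_up_rank)
    show "(\<lambda>p. (p(i := 0)) k) \<in> borel_measurable (PiM ?J (\<lambda>_. borel))" if "k \<in> I" for k
      using that by (cases "k = i") simp_all
  qed
  then have Q_meas: "Q \<in> borel_measurable (PiM ?J (\<lambda>_. borel))"
    unfolding Q_def by measurable
  have "indep_var borel ((\<lambda>p. p i) \<circ> (\<lambda>\<omega>. restrict (\<lambda>k. X k \<omega>) {i}))
      borel (Q \<circ> (\<lambda>\<omega>. restrict (\<lambda>k. X k \<omega>) ?J))"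
    using i by (intro indep_var_compose[OF indep_var_restrict[OF indep]] Q_meas) auto
  also have "(\<lambda>p. p i) \<circ> (\<lambda>\<omega>. restrict (\<lambda>k. X k \<omega>) {i}) = X i"
    by auto
  also have "Q \<circ> (\<lambda>\<omega>. restrict (\<lambda>k. X k \<omega>) ?J) = S"
    unfolding S_def Q_def by (auto simp: fun_eq_iff intro!: step_up_rank_cong fin)
  finally have indep_S: "indep_var borel (X i) borel S" .
  have S_meas [measurable]: "S \<in> borel_measurable M"
    using indep_var_rv2[OF indep_S] .
  have "\<P>(\<omega> in M. X i \<omega> \<le> real r * c \<and> ?R \<omega> = r) / real r = c * \<P>(\<omega> in M. S \<omega> = r)"
    if r: "r \<in> {1..card I}" for r
  proof -
    have "real r * c \<le> real (card I) * c"
      using r c(1) by (intro mult_right_mono) auto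
    then have unif_r: "\<P>(\<omega> in M. X i \<omega> \<le> real r * c) = real r * c"
      using unif c unfolding uniform_01_iff by auto
    have "X i \<omega> \<le> real r * c \<and> ?R \<omega> = r \<longleftrightarrow> X i \<omega> \<le> real r * c \<and> S \<omega> = r" for \<omega>
      unfolding S_def Q_def using step_up_rank_upd_eq_iff[OF fin c(1), of "\<lambda>k. X k \<omega>" i r 0] c(1)
      by auto
    then have "\<P>(\<omega> in M. X i \<omega> \<le> real r * c \<and> ?R \<omega> = r) =
        \<P>(\<omega> in M. X i \<omega> \<le> real r * c \<and> S \<omega> = r)"
      by simp
    also have "\<dots> = \<P>(\<omega> in M. X i \<omega> \<le> real r * c) * \<P>(\<omega> in M. S \<omega> = r)"
      using indep_varD[OF indep_S, of "{..real r * c}" "{r}"]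
      by (simp add: vimage_def Int_def conj_ac)
    finally show ?thesis
      using r unif_r by simp
  qed
  then have "(\<Sum>r\<in>{1..card I}. \<P>(\<omega> in M. X i \<omega> \<le> real r * c \<and> ?R \<omega> = r) / real r) =
      c * (\<Sum>r\<in>{1..card I}. \<P>(\<omega> in M. S \<omega> = r))"
    by (simp add: sum_distrib_left)
  also have "(\<Sum>r\<in>{1..card I}. \<P>(\<omega> in M. S \<omega> = r)) =
      prob (\<Union>r\<in>{1..card I}. {\<omega> \<in> space M. S \<omega> = r})"
    by (intro finite_measure_finite_Union[symmetric]) (auto simp: disjoint_family_on_def)
  also have "(\<Union>r\<in>{1..card I}. {\<omega> \<in> space M. S \<omega> = r}) = space M"
    using step_up_rank_upd_zero_pos[OF fin c(1) i] step_up_rank_le_card[OF fin]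
    by (auto simp: S_def Q_def)
  finally show ?thesis
    by (simp add: prob_space)
qed

end

theorem corollary1:
  fixes M :: "'a measure" and K :: nat and P :: "nat \<Rightarrow> 'a \<Rightarrow> real"
  assumes "prob_space M"
    and "K \<ge> 1"
    and "\<And>k. k \<in> {1..K} \<Longrightarrow> p_variable M (P k)"
  shows "(PRDS M K P {1..K} \<longrightarrow>
           (\<forall>\<alpha>\<in>{0..1}. \<P>(\<omega> in M. simes K (\<lambda>k. P k \<omega>) \<le> \<alpha>) \<le> \<alpha>))
       \<and> (prob_space.indep_vars M (\<lambda>_. borel) P {1..K} \<and> (\<forall>k\<in>{1..K}. uniform_01 M (P k)) \<longrightarrow>
           uniform_01 M (\<lambda>\<omega>. simes K (\<lambda>k. P k \<omega>)))"
proof -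
  interpret prob_space M by fact
  have meas: "P k \<in> borel_measurable M" if "k \<in> {1..K}" for k
    using assms(3)[OF that] by (simp add: p_variable_def)
  let ?R = "\<lambda>\<alpha> \<omega>. step_up_rank {1..K} (\<alpha> / real K) (\<lambda>k. P k \<omega>)"
  have prob_simes: "\<P>(\<omega> in M. simes K (\<lambda>k. P k \<omega>) \<le> \<alpha>) = (\<Sum>i\<in>{1..K}. \<Sum>r\<in>{1..K}.
      \<P>(\<omega> in M. P i \<omega> \<le> real r * (\<alpha> / real K) \<and> ?R \<alpha> \<omega> = r) / real r)" if "0 \<le> \<alpha>" for \<alpha>
    using prob_step_up_rank_pos[of "{1..K}" "\<alpha> / real K" P] that meas
    by (simp add: simes_le_iff[OF assms(2)])
  have const_sum: "(\<Sum>i\<in>{1..K}. \<alpha> / real K) = \<alpha>" for \<alpha> :: real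
    using assms(2) by simp
  show ?thesis
  proof (intro conjI impI ballI)
    fix \<alpha> :: real
    assume PRDS: "PRDS M K P {1..K}" and "\<alpha> \<in> {0..1}"
    then have \<alpha>: "0 \<le> \<alpha>" "\<alpha> \<le> 1"
      by auto
    have "\<P>(\<omega> in M. simes K (\<lambda>k. P k \<omega>) \<le> \<alpha>) \<le> (\<Sum>i\<in>{1..K}. \<alpha> / real K)"
      unfolding prob_simes[OF \<alpha>(1)] using \<alpha> assms(2)
      by (intro sum_mono PRDS_sum_le[OF PRDS] meas assms(3)) auto
    then show "\<P>(\<omega> in M. simes K (\<lambda>k. P k \<omega>) \<le> \<alpha>) \<le> \<alpha>"
      using const_sum by simp
  next
    assume iid: "indep_vars (\<lambda>_. borel) P {1..K} \<and> (\<forall>k\<in>{1..K}. uniform_01 M (P k))"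
    have "\<P>(\<omega> in M. simes K (\<lambda>k. P k \<omega>) \<le> \<alpha>) = \<alpha>" if "\<alpha> \<in> {0..1}" for \<alpha>
    proof -
      have \<alpha>: "0 \<le> \<alpha>" "\<alpha> \<le> 1"
        using that by auto
      have "(\<Sum>r\<in>{1..K}. \<P>(\<omega> in M. P i \<omega> \<le> real r * (\<alpha> / real K) \<and> ?R \<alpha> \<omega> = r) / real r) =
          \<alpha> / real K" if "i \<in> {1..K}" for i
        using indep_uniform_sum_eq[of P "{1..K}" i "\<alpha> / real K"] iid that \<alpha> assms(2) by simp
      then have "\<P>(\<omega> in M. simes K (\<lambda>k. P k \<omega>) \<le> \<alpha>) = (\<Sum>i\<in>{1..K}. \<alpha> / real K)"
        unfolding prob_simes[OF \<alpha>(1)] by (rule sum.cong[OF refl])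
      then show ?thesis
        using const_sum by simp
    qed
    moreover have "(\<lambda>\<omega>. simes K (\<lambda>k. P k \<omega>)) \<in> borel_measurable M"
    proof (rule borel_measurable_iff_le[THEN iffD2], intro allI)
      fix \<alpha>
      have [measurable]: "?R \<alpha> \<in> measurable M (count_space UNIV)"
        using meas by measurable
      show "{\<omega> \<in> space M. simes K (\<lambda>k. P k \<omega>) \<le> \<alpha>} \<in> sets M"
        unfolding simes_le_iff[OF assms(2)] by measurable
    qed
    ultimately show "uniform_01 M (\<lambda>\<omega>. simes K (\<lambda>k. P k \<omega>))"
      unfolding uniform_01_iff by blast
  qed
qed

end
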